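(* There is an absolute constant $C>0$ such that the following holds. Let $n\ge 2$ and $t\ge 1$, let $G$ be an $n$-vertex directed graph of treewidth $t$ with positive arc lengths, and let $M=(V(G),d_G)$ be the shortest-path quasimetric space induced by $G$. Then for every $r>0$ there exists a $(C\,t\log n)$-Lipschitz distribution over $r$-bounded quasipartitions of $M$. (In the paper's notation: an $O(t\log n)$-Lipschitz distribution.)
   Context: A quasimetric space is a pair $(X,d)$ with $d:X\times X\to\mathbb{R}_{\ge 0}\cup\{+\infty\}$ such that $d(x,y)=0$ iff $x=y$, and $d(x,y)\le d(x,z)+d(z,y)$ for all $x,y,z$ (symmetry is not required). The shortest-path quasimetric of a directed graph with arc lengths sets $d_G(u,v)$ to the minimum length of a directed path from $u$ to $v$ ($+\infty$ if none exists). The treewidth of a directed graph is the treewidth of its underlying undirected graph. A quasipartition of $X$ is a reflexive and transitive relation $P\subseteq X\times X$. It is $r$-bounded if $(x,y)\in P$ implies $d(x,y)\le r$. A distribution $\mathcal{D}$ over $r$-bounded quasipartitions is $\beta$-Lipschitz if for all $x,y\in X$, $\Pr_{P\sim\mathcal{D}}[(x,y)\notin P]\le \beta\, d(x,y)/r$. *)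

theory Defs
  imports "Graph_Theory.Graph_Theory" "HOL-Probability.Probability"
begin

section \<open>Treewidth\<close>

text \<open>
  Following the library, a finite simple undirected graph is a symmetric loop-free
  digraph (\<^locale>\<open>pair_graph\<close>).  The library's constant \<^const>\<open>tree\<close> is not usable for such
  graphs: it forbids directed cycles only, so a pair of opposite arcs already violates it,
  while every weakly connected acyclic orientation satisfies it.  In a symmetric loop-free
  digraph the cycles of the undirected graph are exactly the directed cycles
  of length at least 3.
\<close>

definition undirected_tree :: "'i pair_pre_digraph \<Rightarrow> bool" where
  "undirected_tree T \<longleftrightarrow>
     pair_graph T \<and> Digraph_Component.connected (with_proj T) \<and>
     \<not> (\<exists>p. pre_digraph.cycle (with_proj T) p \<and> 3 \<le> length p)"

definition tree_decomposition ::
  "'a pair_pre_digraph \<Rightarrow> 'i pair_pre_digraph \<Rightarrow> ('i \<Rightarrow> 'a set) \<Rightarrow> bool" where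
  "tree_decomposition H T B \<longleftrightarrow>
     undirected_tree T \<and>
     (\<Union>i\<in>pverts T. B i) = pverts H \<and>
     (\<forall>(u, v)\<in>parcs H. \<exists>i\<in>pverts T. u \<in> B i \<and> v \<in> B i) \<and>
     (\<forall>v\<in>pverts H. Digraph_Component.connected (with_proj T \<restriction> {i \<in> pverts T. v \<in> B i}))"

definition decomposition_width :: "'i pair_pre_digraph \<Rightarrow> ('i \<Rightarrow> 'a set) \<Rightarrow> nat" where
  "decomposition_width T B = (MAX i\<in>pverts T. card (B i)) - 1"

text \<open>
  Decomposition trees are finite, so nodes may be taken to be natural numbers.
  \<^const>\<open>mk_symmetric\<close> is the underlying undirected graph of a digraph.
\<close>

definition graph_treewidth :: "'a pair_pre_digraph \<Rightarrow> nat" where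
  "graph_treewidth H =
     (LEAST k. \<exists>(T :: nat pair_pre_digraph) B.
        tree_decomposition H T B \<and> decomposition_width T B = k)"

definition treewidth :: "('a, 'b) pre_digraph \<Rightarrow> nat" where
  "treewidth G = graph_treewidth (mk_symmetric G)"

lemma undirected_tree_single:
  "undirected_tree \<lparr> pverts = {i}, parcs = {} \<rparr>" (is "undirected_tree ?T")
proof -
  have "pair_graph ?T"
    by unfold_locales (simp_all add: symmetric_def sym_def)
  moreover have "Digraph_Component.connected (with_proj ?T)"
    by (simp add: Digraph_Component.connected_def strongly_connected_def reachable_def
        mk_symmetric_def)
  moreover have "\<not> pre_digraph.cycle (with_proj ?T) p" for p
    by (simp add: pre_digraph.cycle_def pre_digraph.awalk_def)
  ultimately show ?thesis
    unfolding undirected_tree_def by blast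
qed

lemma (in wf_digraph) tree_decomposition_single:
  "tree_decomposition (mk_symmetric G) \<lparr> pverts = {i}, parcs = {} \<rparr> (\<lambda>_. verts G)"
proof -
  have "Digraph_Component.connected (with_proj \<lparr> pverts = {i}, parcs = {} \<rparr> \<restriction> {i})"
    by (simp add: Digraph_Component.connected_def strongly_connected_def reachable_def
        mk_symmetric_def)
  then show ?thesis
    by (auto simp: tree_decomposition_def undirected_tree_single mk_symmetric_def)
qed

lemma (in wf_digraph) treewidth_attained:
  "\<exists>(T :: nat pair_pre_digraph) B.
    tree_decomposition (mk_symmetric G) T B \<and> decomposition_width T B = treewidth G"
  unfolding treewidth_def graph_treewidth_def
  by (rule LeastI_ex, intro exI conjI, rule tree_decomposition_single, rule refl)


section \<open>Quasimetric spaces\<close>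

definition quasimetric_on :: "'a set \<Rightarrow> ('a \<Rightarrow> 'a \<Rightarrow> ereal) \<Rightarrow> bool" where
  "quasimetric_on X d \<longleftrightarrow>
     (\<forall>x\<in>X. \<forall>y\<in>X. 0 \<le> d x y \<and> (d x y = 0 \<longleftrightarrow> x = y)) \<and>
     (\<forall>x\<in>X. \<forall>y\<in>X. \<forall>z\<in>X. d x y \<le> d x z + d z y)"

text \<open>
  The shortest-path quasimetric of a digraph with arc lengths is the library's
  \<^const>\<open>wf_digraph.\<mu>\<close>: the infimum of the lengths of all walks, which is \<open>\<infinity>\<close> if there is none
  and, for nonnegative lengths on a finite digraph, is otherwise attained by a path.
\<close>

lemma (in fin_digraph) shortest_path_attained:
  assumes "\<And>e. e \<in> arcs G \<Longrightarrow> 0 < w e" and "\<mu> w u v \<noteq> \<infinity>"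
  shows "\<exists>p. apath u p v \<and> \<mu> w u v = ereal (awalk_cost w p)"
proof -
  have "u \<rightarrow>\<^sup>* v"
    using assms(2) shortest_path_inf by blast
  then show ?thesis
    using min_cost_awalk[of u v w] assms(1) by (metis less_imp_le)
qed

lemma (in fin_digraph) quasimetric_on_shortest_path:
  assumes pos: "\<And>e. e \<in> arcs G \<Longrightarrow> 0 < w e"
  shows "quasimetric_on (verts G) (\<mu> w)"
proof -
  have nonneg: "0 \<le> awalk_cost w p" if "awalk u p v" for u p v
    using pos_cost_pos_awalk_cost[OF that] pos by (meson less_imp_le)
  have ge0: "0 \<le> \<mu> w u v" for u v
    unfolding \<mu>_def by (rule INF_greatest) (use nonneg in auto)
  have refl0: "\<mu> w u u = 0" if "u \<in> verts G" for u
  proof -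
    have "awalk u [] u" using that by (simp add: awalk_Nil_iff)
    from min_cost_le_walk_cost[OF this, of w] have "\<mu> w u u \<le> 0"
      by (simp add: zero_ereal_def)
    with ge0[of u u] show ?thesis by (rule antisym[rotated])
  qed
  have sep: "u = v" if "\<mu> w u v = 0" for u v
  proof -
    have "\<mu> w u v \<noteq> \<infinity>" using that by simp
    with pos obtain p where p: "apath u p v" "\<mu> w u v = ereal (awalk_cost w p)"
      using shortest_path_attained by blast
    then have aw: "awalk u p v" and c0: "awalk_cost w p = 0"
      using that by (auto simp: apath_def)
    show "u = v"
    proof (cases p)
      case Nil
      then show ?thesis using aw by (simp add: awalk_Nil_iff)
    next
      case (Cons e es)
      then have "e \<in> arcs G" "awalk (head G e) es v"
        using aw by (auto simp: awalk_Cons_iff)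
      then have "0 < awalk_cost w p"
        using pos[of e] nonneg[of _ es] Cons by fastforce
      then show ?thesis using c0 by simp
    qed
  qed
  have tri: "\<mu> w x y \<le> \<mu> w x z + \<mu> w z y" for x y z
  proof (cases "\<mu> w x z = \<infinity> \<or> \<mu> w z y = \<infinity>")
    case True
    then show ?thesis using ge0 by auto
  next
    case False
    obtain p where p: "apath x p z" "\<mu> w x z = ereal (awalk_cost w p)"
      using shortest_path_attained pos False by blast
    obtain q where q: "apath z q y" "\<mu> w z y = ereal (awalk_cost w q)"
      using shortest_path_attained pos False by blast
    from p q have "awalk x (p @ q) y"
      by (auto simp: apath_def intro: awalk_appendI)
    from min_cost_le_walk_cost[OF this, of w] p q show ?thesis by simp
  qed
  show ?thesis
    unfolding quasimetric_on_def
  proof (intro conjI ballI)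
    fix x y assume x: "x \<in> verts G"
    show "0 \<le> \<mu> w x y" by (rule ge0)
    show "\<mu> w x y = 0 \<longleftrightarrow> x = y"
    proof
      assume "\<mu> w x y = 0"
      then show "x = y" by (rule sep)
    next
      assume "x = y"
      then show "\<mu> w x y = 0" using refl0[OF x] by simp
    qed
  next
    fix x y z
    show "\<mu> w x y \<le> \<mu> w x z + \<mu> w z y" by (rule tri)
  qed
qed


section \<open>Distributions over quasipartitions\<close>

definition quasipartition :: "'a set \<Rightarrow> ('a \<times> 'a) set \<Rightarrow> bool" where
  "quasipartition X P \<longleftrightarrow> preorder_on X P"

definition r_bounded :: "('a \<Rightarrow> 'a \<Rightarrow> ereal) \<Rightarrow> real \<Rightarrow> ('a \<times> 'a) set \<Rightarrow> bool" where
  "r_bounded d r P \<longleftrightarrow> (\<forall>(x, y)\<in>P. d x y \<le> ereal r)"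

text \<open>
  A finite set carries only finitely many quasipartitions, so a distribution over them
  is a \<^typ>\<open>('a \<times> 'a) set pmf\<close>.
\<close>

definition r_bounded_distribution ::
  "'a set \<Rightarrow> ('a \<Rightarrow> 'a \<Rightarrow> ereal) \<Rightarrow> real \<Rightarrow> ('a \<times> 'a) set pmf \<Rightarrow> bool" where
  "r_bounded_distribution X d r D \<longleftrightarrow>
     (\<forall>P\<in>set_pmf D. quasipartition X P \<and> r_bounded d r P)"

definition lipschitz_distribution ::
  "'a set \<Rightarrow> ('a \<Rightarrow> 'a \<Rightarrow> ereal) \<Rightarrow> real \<Rightarrow> real \<Rightarrow> ('a \<times> 'a) set pmf \<Rightarrow> bool" where
  "lipschitz_distribution X d r \<beta> D \<longleftrightarrow>
     (\<forall>x\<in>X. \<forall>y\<in>X.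
        ereal (measure_pmf.prob D {P. (x, y) \<notin> P}) \<le> ereal \<beta> * d x y / ereal r)"

end

theory Submission
  imports Defs
begin

text \<open>
  Balanced separators of size at most \<open>t + 1\<close>, applied recursively, attach to every vertex \<open>u\<close> a
  set \<open>A u\<close> of \<open>O(t log n)\<close> separator vertices such that every connected set \<open>W\<close> contains a hub:
  a vertex \<open>v \<in> W\<close> with \<open>v \<in> A u\<close> for all \<open>u \<in> W\<close>. Draw one radius \<open>R \<le> r/2\<close> at random and delete
  an arc \<open>(a, b)\<close> if some \<open>v \<in> A a\<close> has an out-ball of radius \<open>R\<close> that the arc leaves or an in-ball of
  radius \<open>R\<close> that it enters; the quasipartition is reachability by the remaining arcs. A remaining
  walk cannot leave the out-ball of its hub, nor can it have entered the in-ball, so its ends are at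
  distance at most \<open>2R\<close>. Each of the \<open>2|A a|\<close> balls deletes the arc with probability
  \<open>O(w(a,b)/r)\<close>, and a union bound over the arcs of a shortest path gives the Lipschitz bound.
\<close>

section \<open>Connected sets and trees\<close>

text \<open>A bare relation \<open>F\<close> serves both the decomposition tree and the underlying
  undirected graph. The empty set counts as connected, so statements about hubs demand
  \<open>W\<close> nonempty separately.\<close>

definition connected_in :: "('a \<times> 'a) set \<Rightarrow> 'a set \<Rightarrow> bool" where
  "connected_in F W \<longleftrightarrow> (\<forall>x\<in>W. \<forall>y\<in>W. (x, y) \<in> (F \<inter> W \<times> W)\<^sup>*)"

lemma connected_inD: "connected_in F W \<Longrightarrow> x \<in> W \<Longrightarrow> y \<in> W \<Longrightarrow> (x, y) \<in> (F \<inter> W \<times> W)\<^sup>*"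
  by (simp add: connected_in_def)

lemma rtrancl_sym: "sym R \<Longrightarrow> (x, y) \<in> R\<^sup>* \<Longrightarrow> (y, x) \<in> R\<^sup>*"
  by (meson sym_rtrancl symD)

text \<open>The library symmetrises the induced subgraph before asking for strong connectivity; as
  \<open>parcs T\<close> is already symmetric, this adds no arcs.\<close>

lemma connected_in_induce_subgraph:
  assumes "Digraph_Component.connected (with_proj T \<restriction> M)" and "sym (parcs T)"
  shows "connected_in (parcs T) M"
proof -
  let ?H = "mk_symmetric (with_proj T \<restriction> M)"
  have sub: "parcs ?H \<subseteq> parcs T \<inter> M \<times> M"
    using assms(2) by (auto simp: parcs_mk_symmetric dest: symD)
  have "(x, y) \<in> (parcs T \<inter> M \<times> M)\<^sup>*" if "x \<in> M" "y \<in> M" for x y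
  proof -
    have "(x, y) \<in> rtrancl_on (pverts ?H) (parcs ?H)"
      using assms(1) that
      by (simp add: Digraph_Component.connected_def strongly_connected_def reachable_def)
    then have "(x, y) \<in> (parcs ?H)\<^sup>*"
      by (rule rtrancl_on_rtranclI)
    then show ?thesis
      using rtrancl_mono[OF sub] by blast
  qed
  then show ?thesis
    by (simp add: connected_in_def)
qed

text \<open>Acyclicity of an undirected graph, phrased with closures instead of cycles. Both
  orientations of an edge are removed together, since either one alone would keep its ends
  joined.\<close>

definition all_bridges :: "('a \<times> 'a) set \<Rightarrow> bool" where
  "all_bridges E \<longleftrightarrow> (\<forall>(i, j)\<in>E. (i, j) \<notin> (E - {(i, j), (j, i)})\<^sup>*)"

lemma all_bridgesD: "all_bridges E \<Longrightarrow> (i, j) \<in> E \<Longrightarrow> (i, j) \<notin> (E - {(i, j), (j, i)})\<^sup>*"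
  by (auto simp: all_bridges_def)

text \<open>A detour around the edge, taken as a simple path and closed by the reverse arc, would be
  a cycle of length at least 3.\<close>

lemma undirected_tree_all_bridges:
  assumes "undirected_tree T"
  shows "all_bridges (parcs T)"
  unfolding all_bridges_def
proof clarify
  fix a b
  assume ab: "(a, b) \<in> parcs T" and reach: "(a, b) \<in> (parcs T - {(a, b), (b, a)})\<^sup>*"
  interpret T: pair_graph T
    using assms by (simp add: undirected_tree_def)
  let ?T' = "\<lparr>pverts = pverts T, parcs = parcs T - {(a, b), (b, a)}\<rparr>"
  interpret T': pair_wf_digraph ?T'
    by unfold_locales (auto dest: T.in_arcsD1 T.in_arcsD2)
  have "(a, b) \<in> rtrancl_on (pverts T) (parcs T - {(a, b), (b, a)})"
    by (rule rtrancl_consistent_rtrancl_on[OF reach])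
       (use ab in \<open>auto dest: T.in_arcsD1 T.in_arcsD2\<close>)
  then have "a \<rightarrow>\<^sup>*\<^bsub>with_proj ?T'\<^esub> b"
    by (simp add: reachable_def)
  then obtain p where p: "T'.apath a p b"
    using T'.reachable_apath by blast
  then have aw': "T'.awalk a p b" and dist: "distinct (pawalk_verts a p)"
    by (auto simp: T'.apath_def)
  have aw: "T.awalk a p b"
    using aw' by (auto simp: T'.awalk_def T.awalk_def)
  have "(b, a) \<in> parcs T"
    using ab T.pair_sym_arcs by (auto simp: symmetric_def dest: symD)
  then have "T.awalk b ((b, a) # p) b"
    using aw by (auto simp: T.awalk_Cons_iff)
  moreover have "pawalk_verts b ((b, a) # p) = b # pawalk_verts a p"
    by simp
  ultimately have cyc: "T.cycle ((b, a) # p)"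
    using dist by (force simp: T.cycle_def)
  have "a \<noteq> b"
    using T.pair_no_loops[OF ab] by simp
  \<comment> \<open>An empty path would force \<open>a = b\<close>, and a single arc would be the
    removed \<open>(a, b)\<close>.\<close>
  have "2 \<le> length p"
  proof (rule ccontr)
    assume "\<not> 2 \<le> length p"
    then consider "p = []" | e where "p = [e]"
      by (cases p; cases "tl p") auto
    then show False
      using aw' \<open>a \<noteq> b\<close> by cases (auto simp: T'.awalk_def)
  qed
  then show False
    using assms cyc by (auto simp: undirected_tree_def)
qed

text \<open>The walk is cut after its last visit to \<open>i\<close>.\<close>

lemma rtrancl_avoiding_start:
  assumes "(i, k) \<in> E\<^sup>*" and "i \<noteq> k"
  shows "\<exists>j. (i, j) \<in> E \<and> j \<noteq> i \<and> (j, k) \<in> (E \<inter> (- {i}) \<times> (- {i}))\<^sup>*"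
  using assms
proof (induction rule: rtrancl_induct)
  case (step y z)
  show ?case
  proof (cases "i = y")
    case True
    then show ?thesis using step by blast
  next
    case False
    then obtain j where j: "(i, j) \<in> E" "j \<noteq> i" "(j, y) \<in> (E \<inter> (- {i}) \<times> (- {i}))\<^sup>*"
      using step by blast
    have "(y, z) \<in> E \<inter> (- {i}) \<times> (- {i})"
      using step False by auto
    with j show ?thesis
      by (meson rtrancl.rtrancl_into_rtrancl)
  qed
qed simp

text \<open>
  A weak form of the Helly property of subtrees. Each \<open>K i\<close> lies on one side of \<open>i\<close>, entered by an
  edge \<open>(i, f i)\<close>; for an \<open>i\<close> whose side is smallest, the choice at \<open>f i\<close> cannot point back to \<open>i\<close>,
  hence it gives a smaller side.
\<close>

lemma no_avoiding_pairwise_meeting_subtrees: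
  assumes fin: "finite N" and "N \<noteq> {}" and EN: "E \<subseteq> N \<times> N" and sym: "sym E"
    and conn: "connected_in E N" and br: "all_bridges E"
    and KN: "\<And>i. i \<in> N \<Longrightarrow> K i \<subseteq> N"
    and avoid: "\<And>i. i \<in> N \<Longrightarrow> i \<notin> K i"
    and connK: "\<And>i. i \<in> N \<Longrightarrow> connected_in E (K i)"
    and meet: "\<And>i j. i \<in> N \<Longrightarrow> j \<in> N \<Longrightarrow> K i \<inter> K j \<noteq> {}"
  shows False
proof -
  \<comment> \<open>For a neighbour \<open>j\<close> of \<open>i\<close>, \<open>side i j\<close> is
    the branch of the tree at \<open>i\<close> that starts with \<open>j\<close>.\<close>
  define Av where "Av i = E \<inter> (- {i}) \<times> (- {i})" for i
  define side where "side i j = (Av i)\<^sup>* `` {j}" for i j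
  have "\<exists>j. (i, j) \<in> E \<and> j \<noteq> i \<and> K i \<subseteq> side i j" if i: "i \<in> N" for i
  proof -
    obtain k where k: "k \<in> K i" using meet[OF i i] by auto
    have "(i, k) \<in> (E \<inter> N \<times> N)\<^sup>*"
      using connected_inD[OF conn i] k KN[OF i] by auto
    then have "(i, k) \<in> E\<^sup>*"
      using rtrancl_mono[of "E \<inter> N \<times> N" E] by auto
    moreover have "i \<noteq> k" using k avoid[OF i] by auto
    ultimately obtain j where j: "(i, j) \<in> E" "j \<noteq> i" "(j, k) \<in> (Av i)\<^sup>*"
      using rtrancl_avoiding_start[of i k E] by (auto simp: Av_def)
    have "E \<inter> K i \<times> K i \<subseteq> Av i"
      using avoid[OF i] by (auto simp: Av_def)
    then have "(k, l) \<in> (Av i)\<^sup>*" if "l \<in> K i" for l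
      using connected_inD[OF connK[OF i] k that] rtrancl_mono by blast
    then have "K i \<subseteq> side i j"
      using j(3) by (auto simp: side_def intro: rtrancl_trans)
    with j show ?thesis by blast
  qed
  then obtain f where f: "\<And>i. i \<in> N \<Longrightarrow> (i, f i) \<in> E \<and> f i \<noteq> i \<and> K i \<subseteq> side i (f i)"
    by metis
  have sideN: "side i j \<subseteq> N" if "j \<in> N" for i j
  proof
    fix x assume "x \<in> side i j"
    then have "(j, x) \<in> (Av i)\<^sup>*" by (simp add: side_def)
    then show "x \<in> N"
      using that EN by (induction rule: rtrancl_induct) (auto simp: Av_def)
  qed
  have symAv: "sym (Av i)" for i
    using sym by (auto simp: Av_def sym_def)
  obtain i where i: "i \<in> N" and min: "\<And>j. j \<in> N \<Longrightarrow> card (side i (f i)) \<le> card (side j (f j))"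
    using ex_has_least_nat[of "\<lambda>i. i \<in> N" _ "\<lambda>i. card (side i (f i))"] \<open>N \<noteq> {}\<close> by blast
  define j where "j = f i"
  define l where "l = f j"
  have ij: "(i, j) \<in> E" "j \<noteq> i" using f[OF i] by (auto simp: j_def)
  have jN: "j \<in> N" using ij EN by auto
  have jl: "(j, l) \<in> E" "l \<noteq> j" using f[OF jN] by (auto simp: l_def)
  have lN: "l \<in> N" using jl EN by auto
  let ?E' = "E - {(i, j), (j, i)}"
  have sub: "Av i \<subseteq> ?E'" "Av j \<subseteq> ?E'"
    by (auto simp: Av_def)
  have symE': "sym ?E'" using sym by (auto simp: sym_def)
  have nobridge: "(j, i) \<notin> ?E'\<^sup>*"
    using all_bridgesD[OF br ij(1)] rtrancl_sym[OF symE'] by blast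
  \<comment> \<open>Otherwise a common point of \<open>K i\<close> and \<open>K j\<close> is reached
    from \<open>j\<close> avoiding \<open>i\<close> and from \<open>i\<close> avoiding
    \<open>j\<close>; joined, the two walks bypass the bridge between \<open>i\<close> and
    \<open>j\<close>.\<close>
  have li: "l \<noteq> i"
  proof
    assume "l = i"
    obtain k where "k \<in> K i" "k \<in> K j" using meet[OF i jN] by auto
    then have "(j, k) \<in> (Av i)\<^sup>*" "(i, k) \<in> (Av j)\<^sup>*"
      using f[OF i] f[OF jN] \<open>l = i\<close> by (auto simp: j_def l_def side_def)
    then have "(j, k) \<in> ?E'\<^sup>*" "(i, k) \<in> ?E'\<^sup>*"
      using sub rtrancl_mono by blast+
    then show False
      using nobridge rtrancl_sym[OF symE'] rtrancl_trans by meson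
  qed
  have iside: "i \<notin> side j l"
  proof
    assume "i \<in> side j l"
    then have "(l, i) \<in> ?E'\<^sup>*"
      using sub rtrancl_mono unfolding side_def by blast
    moreover have "(j, l) \<in> ?E'" using jl li by auto
    ultimately show False using nobridge by (meson converse_rtrancl_into_rtrancl)
  qed
  \<comment> \<open>Walks in the branch behind \<open>l\<close> never meet \<open>i\<close>, so with
    the edge from \<open>j\<close> to \<open>l\<close> in front they stay in the branch of
    \<open>j\<close> at \<open>i\<close>. The vertex \<open>j\<close> itself makes the inclusion
    strict.\<close>
  have "side j l \<subseteq> side i j"
  proof
    fix x assume "x \<in> side j l"
    then have "(l, x) \<in> (Av j)\<^sup>*" by (simp add: side_def)
    then have "(j, x) \<in> (Av i)\<^sup>*"
    proof (induction rule: rtrancl_induct)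
      case base
      have "(j, l) \<in> Av i" using jl li ij by (auto simp: Av_def)
      then show ?case by blast
    next
      case (step y z)
      have "y \<noteq> i" using iside step(1) by (auto simp: side_def)
      moreover have "z \<noteq> i" using iside rtrancl.rtrancl_into_rtrancl[OF step(1,2)] by (auto simp: side_def)
      ultimately have "(y, z) \<in> Av i" using step(2) by (auto simp: Av_def)
      then show ?case using step(3) by (meson rtrancl.rtrancl_into_rtrancl)
    qed
    then show "x \<in> side i j" by (simp add: side_def)
  qed
  moreover have "j \<in> side i j" by (simp add: side_def)
  moreover have "j \<notin> side j l"
  proof
    assume "j \<in> side j l"
    then have "(l, j) \<in> (Av j)\<^sup>*" by (simp add: side_def)
    then show False using jl(2) by (auto elim!: rtranclE simp: Av_def)
  qed
  ultimately have "side j l \<subset> side i j" by blast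
  then have "card (side j l) < card (side i j)"
    by (meson psubset_card_mono finite_subset[OF sideN[OF jN] fin])
  then show False
    using min[OF jN] by (simp add: j_def l_def)
qed

section \<open>Balanced separators and hubs\<close>

text \<open>If every bag failed, each node \<open>i\<close> would have a connected
  \<open>W i\<close> missing its bag and holding more than half of \<open>U\<close>. The nodes whose
  bags meet \<open>W i\<close> form a subtree avoiding \<open>i\<close>, and these subtrees meet
  pairwise, which is impossible in a tree.\<close>

lemma tree_decomposition_balanced_separator:
  assumes td: "tree_decomposition H T B" and U: "finite U" "U \<subseteq> pverts H"
  shows "\<exists>i\<in>pverts T. \<forall>W. W \<subseteq> U - B i \<and> connected_in (parcs H) W \<longrightarrow> 2 * card W \<le> card U"
proof (rule ccontr)
  assume "\<not> ?thesis"
  then have "\<forall>i\<in>pverts T. \<exists>W. W \<subseteq> U - B i \<and> connected_in (parcs H) W \<and> card U < 2 * card W"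
    by (auto simp: not_le)
  then obtain W where W: "\<And>i. i \<in> pverts T \<Longrightarrow> W i \<subseteq> U - B i"
      "\<And>i. i \<in> pverts T \<Longrightarrow> connected_in (parcs H) (W i)"
      "\<And>i. i \<in> pverts T \<Longrightarrow> card U < 2 * card (W i)"
    by metis
  have tree: "undirected_tree T"
    and cover: "(\<Union>i\<in>pverts T. B i) = pverts H"
    and edge: "\<And>u v. (u, v) \<in> parcs H \<Longrightarrow> \<exists>i\<in>pverts T. u \<in> B i \<and> v \<in> B i"
    and bags: "\<And>v. v \<in> pverts H \<Longrightarrow>
      Digraph_Component.connected (with_proj T \<restriction> {i \<in> pverts T. v \<in> B i})"
    using td by (auto simp: tree_decomposition_def)
  interpret T: pair_graph T
    using tree by (simp add: undirected_tree_def)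
  have symT: "sym (parcs T)"
    using T.pair_sym_arcs by (simp add: symmetric_def)
  have connT: "Digraph_Component.connected (with_proj T)"
    using tree by (simp add: undirected_tree_def)
  have TN: "parcs T \<subseteq> pverts T \<times> pverts T"
    using T.in_arcsD1 T.in_arcsD2 by auto
  have restr: "with_proj T \<restriction> pverts T = with_proj T"
    using TN by (auto simp: induce_subgraph_def with_proj_def)
  define K where "K i = {k \<in> pverts T. B k \<inter> W i \<noteq> {}}" for i
  have connK: "connected_in (parcs T) (K i)" if i: "i \<in> pverts T" for i
  proof -
    have same: "(k, l) \<in> (parcs T \<inter> K i \<times> K i)\<^sup>*"
      if v: "v \<in> W i" and "k \<in> pverts T" "v \<in> B k" "l \<in> pverts T" "v \<in> B l" for v k l
    proof -
      let ?M = "{i \<in> pverts T. v \<in> B i}"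
      have "v \<in> pverts H" using v W(1)[OF i] U by auto
      then have "(k, l) \<in> (parcs T \<inter> ?M \<times> ?M)\<^sup>*"
        using connected_inD[OF connected_in_induce_subgraph[OF bags symT]] that by auto
      moreover have "parcs T \<inter> ?M \<times> ?M \<subseteq> parcs T \<inter> K i \<times> K i"
        using v by (auto simp: K_def)
      ultimately show ?thesis using rtrancl_mono by blast
    qed
    \<comment> \<open>Along a walk in \<open>W i\<close>, consecutive vertices share a bag, which
      links the subtrees of bags containing them.\<close>
    have move: "\<forall>k l. k \<in> pverts T \<and> u \<in> B k \<and> l \<in> pverts T \<and> v \<in> B l \<longrightarrow>
        (k, l) \<in> (parcs T \<inter> K i \<times> K i)\<^sup>*"
      if "(u, v) \<in> (parcs H \<inter> W i \<times> W i)\<^sup>*" "u \<in> W i" for u v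
      using that
    proof (induction rule: rtrancl_induct)
      case base
      then show ?case using same by blast
    next
      case (step y z)
      obtain m where m: "m \<in> pverts T" "y \<in> B m" "z \<in> B m"
        using edge[of y z] step by auto
      show ?case
      proof clarify
        fix k l assume kl: "k \<in> pverts T" "u \<in> B k" "l \<in> pverts T" "z \<in> B l"
        have "(k, m) \<in> (parcs T \<inter> K i \<times> K i)\<^sup>*"
          using step m kl by blast
        moreover have "(m, l) \<in> (parcs T \<inter> K i \<times> K i)\<^sup>*"
          using same[of z m l] step m kl by blast
        ultimately show "(k, l) \<in> (parcs T \<inter> K i \<times> K i)\<^sup>*"
          by (rule rtrancl_trans)
      qed
    qed
    show ?thesis
      unfolding connected_in_def
    proof (intro ballI)
      fix k l assume kl: "k \<in> K i" "l \<in> K i"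
      then obtain u v where "u \<in> W i" "u \<in> B k" "v \<in> W i" "v \<in> B l"
        by (auto simp: K_def)
      then show "(k, l) \<in> (parcs T \<inter> K i \<times> K i)\<^sup>*"
        using move[OF connected_inD[OF W(2)[OF i]]] kl by (auto simp: K_def)
    qed
  qed
  have meet: "K i \<inter> K j \<noteq> {}" if ij: "i \<in> pverts T" "j \<in> pverts T" for i j
  proof -
    \<comment> \<open>Two subsets of \<open>U\<close>, each larger than half of it, cannot be
      disjoint.\<close>
    have "W i \<inter> W j \<noteq> {}"
    proof
      assume "W i \<inter> W j = {}"
      moreover have sub: "W i \<union> W j \<subseteq> U" using W(1) ij by blast
      moreover have "finite (W i)" "finite (W j)"
        using sub U(1) finite_subset by auto
      ultimately have "card (W i) + card (W j) \<le> card U"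
        using card_Un_disjoint[of "W i" "W j"] card_mono[OF U(1) sub] by simp
      then show False using W(3)[OF ij(1)] W(3)[OF ij(2)] by simp
    qed
    then obtain v where v: "v \<in> W i" "v \<in> W j" by blast
    then have "v \<in> pverts H" using W(1) ij U by blast
    then obtain k where "k \<in> pverts T" "v \<in> B k" using cover by blast
    with v show ?thesis by (auto simp: K_def)
  qed
  show False
  proof (rule no_avoiding_pairwise_meeting_subtrees[of "pverts T" "parcs T" K])
    show "pverts T \<noteq> {}"
      using connT by (simp add: Digraph_Component.connected_def strongly_connected_def)
    show "connected_in (parcs T) (pverts T)"
      by (rule connected_in_induce_subgraph[OF _ symT]) (simp add: restr connT)
    show "i \<notin> K i" if "i \<in> pverts T" for i
      using W(1)[OF that] by (auto simp: K_def)
  qed (use T.pair_finite_verts TN symT undirected_tree_all_bridges[OF tree] connK meet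
       in \<open>auto simp: K_def\<close>)
qed

text \<open>A separator \<open>S\<close> of \<open>U\<close> is given to all vertices. A connected
  \<open>W\<close> meeting \<open>S\<close> has its hub there; any other lies in one component of
  \<open>U - S\<close>, which is at most half as large and is treated recursively. Each of the
  \<open>k\<close> levels costs at most \<open>s\<close> elements.\<close>

lemma hubs_of_balanced_separators:
  assumes symF: "sym F"
    and sep: "\<And>U. U \<subseteq> V \<Longrightarrow> \<exists>S. finite S \<and> card S \<le> s \<and>
      (\<forall>W. W \<subseteq> U - S \<and> connected_in F W \<longrightarrow> 2 * card W \<le> card U)"
  shows "U \<subseteq> V \<Longrightarrow> card U < 2 ^ k \<Longrightarrow> finite U \<Longrightarrow>
    \<exists>A. (\<forall>u. finite (A u) \<and> card (A u) \<le> k * s) \<and>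
      (\<forall>W. W \<subseteq> U \<and> W \<noteq> {} \<and> connected_in F W \<longrightarrow> (\<exists>v\<in>W. \<forall>u\<in>W. v \<in> A u))"
proof (induction k arbitrary: U)
  case 0
  then show ?case by (intro exI[of _ "\<lambda>_. {}"]) auto
next
  case (Suc k)
  obtain S where S: "finite S" "card S \<le> s"
      "\<And>W. W \<subseteq> U - S \<Longrightarrow> connected_in F W \<Longrightarrow> 2 * card W \<le> card U"
    using sep[OF Suc.prems(1)] by blast
  let ?R = "F \<inter> (U - S) \<times> (U - S)"
  \<comment> \<open>For \<open>u\<close> in \<open>U - S\<close>, this is the component of
    \<open>u\<close>.\<close>
  define c where "c u = ?R\<^sup>* `` {u}" for u
  have symR: "sym ?R" using symF by (auto simp: sym_def)
  have csub: "c u \<subseteq> U - S" if "u \<in> U - S" for u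
  proof
    fix x assume "x \<in> c u"
    then have "(u, x) \<in> ?R\<^sup>*" by (simp add: c_def)
    then show "x \<in> U - S" using that by (induction rule: rtrancl_induct) auto
  qed
  have ceq: "c x = c u" if "x \<in> c u" for x u
  proof -
    have "(u, x) \<in> ?R\<^sup>*" "(x, u) \<in> ?R\<^sup>*"
      using that rtrancl_sym[OF symR] by (auto simp: c_def)
    then show ?thesis unfolding c_def by (auto intro: rtrancl_trans)
  qed
  have inside: "(u, y) \<in> (F \<inter> c u \<times> c u)\<^sup>*" if "y \<in> c u" for u y
  proof -
    have "(u, y) \<in> ?R\<^sup>*" using that by (simp add: c_def)
    then show ?thesis
    proof (induction rule: rtrancl_induct)
      case (step y z)
      have "(u, z) \<in> ?R\<^sup>*" using step(1,2) by (rule rtrancl.rtrancl_into_rtrancl)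
      then have "(y, z) \<in> F \<inter> c u \<times> c u" using step(1,2) by (simp add: c_def)
      with step(3) show ?case by (rule rtrancl.rtrancl_into_rtrancl)
    qed simp
  qed
  have cconn: "connected_in F (c u)" for u
    unfolding connected_in_def
  proof (intro ballI)
    fix x y assume "x \<in> c u" "y \<in> c u"
    then show "(x, y) \<in> (F \<inter> c u \<times> c u)\<^sup>*"
      using inside[of y x] ceq[of x u] by auto
  qed
  have "\<exists>A. (\<forall>u. finite (A u) \<and> card (A u) \<le> k * s) \<and>
      (\<forall>W. W \<subseteq> C \<and> W \<noteq> {} \<and> connected_in F W \<longrightarrow> (\<exists>v\<in>W. \<forall>u\<in>W. v \<in> A u))"
    if C: "C \<in> c ` (U - S)" for C
  proof (rule Suc.IH)
    obtain u where u: "u \<in> U - S" "C = c u" using C by blast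
    show "C \<subseteq> V" using csub u Suc.prems(1) by auto
    show "finite C" using csub u Suc.prems(3) finite_subset by blast
    show "card C < 2 ^ k"
      using S(3)[OF csub[OF u(1)] cconn] Suc.prems(2) u(2) by simp
  qed
  then obtain A where A: "\<And>C u. C \<in> c ` (U - S) \<Longrightarrow> finite (A C u) \<and> card (A C u) \<le> k * s"
      "\<And>C W. C \<in> c ` (U - S) \<Longrightarrow> W \<subseteq> C \<Longrightarrow> W \<noteq> {} \<Longrightarrow> connected_in F W \<Longrightarrow>
         \<exists>v\<in>W. \<forall>u\<in>W. v \<in> A C u"
    by metis
  define A' where "A' u = S \<union> (if u \<in> U - S then A (c u) u else {})" for u
  have "finite (A' u)" for u
    using A(1)[of "c u" u] S(1) by (auto simp: A'_def)
  moreover have "card (A' u) \<le> Suc k * s" for u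
  proof -
    have "card (A' u) \<le> card S + card (if u \<in> U - S then A (c u) u else {})"
      unfolding A'_def by (rule card_Un_le)
    also have "\<dots> \<le> s + k * s"
      using S(2) A(1)[of "c u" u] by (intro add_mono) auto
    finally show ?thesis by simp
  qed
  moreover have "\<exists>v\<in>W. \<forall>u\<in>W. v \<in> A' u" if W: "W \<subseteq> U" "W \<noteq> {}" "connected_in F W" for W
  proof (cases "W \<inter> S = {}")
    case True
    obtain u where u: "u \<in> W" using W by auto
    have WUS: "W \<subseteq> U - S" using True W by auto
    have "W \<subseteq> c u"
    proof
      fix x assume "x \<in> W"
      then have "(u, x) \<in> (F \<inter> W \<times> W)\<^sup>*" by (rule connected_inD[OF W(3) u])
      moreover have "F \<inter> W \<times> W \<subseteq> ?R" using WUS by auto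
      ultimately show "x \<in> c u" unfolding c_def using rtrancl_mono by blast
    qed
    then obtain v where "v \<in> W" "\<forall>x\<in>W. v \<in> A (c u) x"
      using A(2)[of "c u" W] W u WUS by blast
    moreover have "c x = c u" if "x \<in> W" for x
      using ceq that \<open>W \<subseteq> c u\<close> by auto
    ultimately show ?thesis using WUS by (auto simp: A'_def)
  next
    case False
    then show ?thesis by (auto simp: A'_def)
  qed
  ultimately show ?case by blast
qed

lemma (in fin_digraph) hubs_of_treewidth:
  assumes "card (verts G) < 2 ^ k"
  shows "\<exists>A. (\<forall>u. finite (A u) \<and> card (A u) \<le> k * (treewidth G + 1)) \<and>
    (\<forall>W. W \<subseteq> verts G \<and> W \<noteq> {} \<and> connected_in (parcs (mk_symmetric G)) W \<longrightarrow>
      (\<exists>v\<in>W. \<forall>u\<in>W. v \<in> A u))"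
proof -
  obtain T :: "nat pair_pre_digraph" and B where
    td: "tree_decomposition (mk_symmetric G) T B" and w: "decomposition_width T B = treewidth G"
    using treewidth_attained by blast
  have finT: "finite (pverts T)"
    using td by (simp add: tree_decomposition_def undirected_tree_def pair_graph_def
        pair_digraph_def pair_fin_digraph_def pair_fin_digraph_axioms_def)
  have cover: "(\<Union>i\<in>pverts T. B i) = verts G"
    using td by (simp add: tree_decomposition_def)
  show ?thesis
  proof (rule hubs_of_balanced_separators[OF _ _ subset_refl assms finite_verts])
    show "sym (parcs (mk_symmetric G))"
      by (auto simp: parcs_mk_symmetric sym_def)
    fix U assume U: "U \<subseteq> verts G"
    then obtain i where i: "i \<in> pverts T"
      "\<forall>W. W \<subseteq> U - B i \<and> connected_in (parcs (mk_symmetric G)) W \<longrightarrow> 2 * card W \<le> card U"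
      using tree_decomposition_balanced_separator[OF td, of U] finite_subset[OF U finite_verts]
      by auto
    have "card (B i) \<le> (MAX i\<in>pverts T. card (B i))"
      using i(1) finT by (intro Max_ge) auto
    \<comment> \<open>This undoes the \<open>- 1\<close> in \<open>decomposition_width\<close>;
      truncation at 0 does no harm to an upper bound.\<close>
    then have "card (B i) \<le> treewidth G + 1"
      using w by (simp add: decomposition_width_def)
    moreover have "finite (B i)"
      using cover i(1) finite_subset[OF _ finite_verts] by blast
    ultimately show "\<exists>S. finite S \<and> card S \<le> treewidth G + 1 \<and> (\<forall>W. W \<subseteq> U - S \<and>
        connected_in (parcs (mk_symmetric G)) W \<longrightarrow> 2 * card W \<le> card U)"
      using i(2) by blast
  qed
qed

section \<open>Reachability by uncut arcs\<close>

text \<open>This makes the vertex set of a walk eligible for a hub.\<close>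

lemma connected_in_walk:
  assumes "sym F" and "successively (\<lambda>a b. (a, b) \<in> F) p"
  shows "connected_in F (set p)"
  using assms(2)
proof (induction p)
  case (Cons a p)
  show ?case
  proof (cases "p = []")
    case False
    let ?R = "F \<inter> set (a # p) \<times> set (a # p)"
    have symR: "sym ?R" using assms(1) by (auto simp: sym_def)
    have ah: "(a, hd p) \<in> ?R" and IH: "connected_in F (set p)"
      using Cons False by (auto simp: successively_Cons)
    have "(F \<inter> set p \<times> set p)\<^sup>* \<subseteq> ?R\<^sup>*"
      by (rule rtrancl_mono) auto
    then have p: "(x, y) \<in> ?R\<^sup>*" if "x \<in> set p" "y \<in> set p" for x y
      using connected_inD[OF IH that] by blast
    have "(a, x) \<in> ?R\<^sup>*" if "x \<in> set p" for x
      using converse_rtrancl_into_rtrancl[OF ah p] that False by simp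
    with p rtrancl_sym[OF symR] show ?thesis
      by (auto simp: connected_in_def)
  qed (simp add: connected_in_def)
qed (simp add: connected_in_def)

lemma rtrancl_imp_walk:
  assumes "(x, y) \<in> Q\<^sup>*"
  shows "\<exists>p. p \<noteq> [] \<and> hd p = x \<and> last p = y \<and> successively (\<lambda>a b. (a, b) \<in> Q) p"
  using assms
proof (induction rule: rtrancl_induct)
  case base
  show ?case by (rule exI[of _ "[x]"]) simp
next
  case (step y z)
  then obtain p where "p \<noteq> []" "hd p = x" "last p = y" "successively (\<lambda>a b. (a, b) \<in> Q) p"
    by blast
  then show ?case
    using step(2) by (intro exI[of _ "p @ [z]"]) (auto simp: successively_append_iff)
qed

context wf_digraph
begin

text \<open>Consulting the set of the tail only is enough, because a hub of a walk lies in
  \<open>A u\<close> for every vertex \<open>u\<close> of it. The balls are closed.\<close>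

definition cut_arc :: "('b \<Rightarrow> real) \<Rightarrow> ('a \<Rightarrow> 'a set) \<Rightarrow> real \<Rightarrow> 'a \<Rightarrow> 'a \<Rightarrow> bool" where
  "cut_arc w A R a b \<longleftrightarrow> (\<exists>v\<in>A a. \<mu> w v a \<le> ereal R \<and> ereal R < \<mu> w v b \<or>
     \<mu> w b v \<le> ereal R \<and> ereal R < \<mu> w a v)"

definition uncut_arcs :: "('b \<Rightarrow> real) \<Rightarrow> ('a \<Rightarrow> 'a set) \<Rightarrow> real \<Rightarrow> ('a \<times> 'a) set" where
  "uncut_arcs w A R = {(a, b) \<in> arcs_ends G. \<not> cut_arc w A R a b}"

text \<open>The closure is reflexive on the whole type, hence the restriction to
  \<open>verts G\<close>.\<close>

definition uncut_reach :: "('b \<Rightarrow> real) \<Rightarrow> ('a \<Rightarrow> 'a set) \<Rightarrow> real \<Rightarrow> ('a \<times> 'a) set" where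
  "uncut_reach w A R = (uncut_arcs w A R)\<^sup>* \<inter> verts G \<times> verts G"

lemma quasipartition_uncut_reach: "quasipartition (verts G) (uncut_reach w A R)"
  unfolding quasipartition_def preorder_on_def uncut_reach_def
  by (auto simp: refl_on_def intro!: transI intro: rtrancl_trans)

lemma uncut_walk_stays_in_out_ball:
  assumes "successively (\<lambda>a b. (a, b) \<in> uncut_arcs w A R) (a # q)"
    and "\<forall>u\<in>set (a # q). v \<in> A u" and "\<mu> w v a \<le> ereal R"
  shows "\<mu> w v (last (a # q)) \<le> ereal R"
  using assms
proof (induction q arbitrary: a)
  case (Cons b q)
  then have "(a, b) \<in> uncut_arcs w A R" "v \<in> A a" by auto
  then have "\<mu> w v b \<le> ereal R"
    using Cons.prems(3) by (auto simp: uncut_arcs_def cut_arc_def not_less)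
  then show ?case using Cons by auto
qed simp

text \<open>No uncut arc enters the in-ball, so membership passes back from head to tail, starting
  at the end of the walk.\<close>

lemma uncut_walk_stays_in_in_ball:
  assumes "successively (\<lambda>a b. (a, b) \<in> uncut_arcs w A R) p" and "p \<noteq> []"
    and "\<forall>u\<in>set p. v \<in> A u" and "\<mu> w (last p) v \<le> ereal R"
  shows "\<mu> w (hd p) v \<le> ereal R"
  using assms
proof (induction p)
  case (Cons a p)
  show ?case
  proof (cases "p = []")
    case False
    then have "(a, hd p) \<in> uncut_arcs w A R" "v \<in> A a" "\<mu> w (hd p) v \<le> ereal R"
      using Cons by (auto simp: successively_Cons)
    then show ?thesis
      by (auto simp: uncut_arcs_def cut_arc_def not_less)
  qed (use Cons in simp)
qed simp

end

context fin_digraph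
begin

context
  fixes w :: "'b \<Rightarrow> real"
  assumes pos: "\<And>e. e \<in> arcs G \<Longrightarrow> 0 < w e"
begin

lemma shortest_path_nonneg: "x \<in> verts G \<Longrightarrow> y \<in> verts G \<Longrightarrow> 0 \<le> \<mu> w x y"
  and shortest_path_refl: "x \<in> verts G \<Longrightarrow> \<mu> w x x = 0"
  and shortest_path_triangle: "x \<in> verts G \<Longrightarrow> y \<in> verts G \<Longrightarrow> z \<in> verts G \<Longrightarrow>
    \<mu> w x y \<le> \<mu> w x z + \<mu> w z y"
  using quasimetric_on_shortest_path[of w] pos by (auto simp: quasimetric_on_def)

text \<open>The walk is split at its hub \<open>v\<close>: the part before \<open>v\<close> lies in
  the in-ball, the part after it in the out-ball, and each contributes at most
  \<open>R\<close>.\<close>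

lemma r_bounded_uncut_reach:
  assumes hubs: "\<And>W. W \<subseteq> verts G \<Longrightarrow> W \<noteq> {} \<Longrightarrow> connected_in (parcs (mk_symmetric G)) W \<Longrightarrow>
      \<exists>v\<in>W. \<forall>u\<in>W. v \<in> A u"
    and R: "0 \<le> R" "2 * R \<le> r"
  shows "r_bounded (\<mu> w) r (uncut_reach w A R)"
  unfolding r_bounded_def
proof clarify
  fix x y assume "(x, y) \<in> uncut_reach w A R"
  then have xy: "x \<in> verts G" "y \<in> verts G" "(x, y) \<in> (uncut_arcs w A R)\<^sup>*"
    by (auto simp: uncut_reach_def)
  let ?F = "parcs (mk_symmetric G)"
  obtain p where p: "p \<noteq> []" "hd p = x" "last p = y"
      "successively (\<lambda>a b. (a, b) \<in> uncut_arcs w A R) p"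
    using rtrancl_imp_walk[OF xy(3)] by blast
  have "sym ?F"
    by (auto simp: parcs_mk_symmetric sym_def)
  moreover have "successively (\<lambda>a b. (a, b) \<in> ?F) p"
    by (rule successively_mono[OF p(4)])
       (auto simp: uncut_arcs_def parcs_mk_symmetric arcs_ends_conv)
  ultimately have "connected_in ?F (set p)"
    by (rule connected_in_walk)
  moreover have "set p \<subseteq> verts G"
    using p(1,2,4) xy(1)
  proof (induction p arbitrary: x)
    case (Cons a p)
    then show ?case
      by (cases p) (auto simp: uncut_arcs_def dest: adj_in_verts)
  qed simp
  ultimately obtain v where v: "v \<in> set p" "\<forall>u\<in>set p. v \<in> A u" and vG: "v \<in> verts G"
    using hubs[of "set p"] p(1) by auto
  obtain p1 p2 where split: "p = p1 @ v # p2"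
    using v(1) by (auto simp: in_set_conv_decomp)
  have v0: "\<mu> w v v \<le> ereal R"
    using shortest_path_refl[OF vG] R by simp
  have "\<mu> w v (last (v # p2)) \<le> ereal R"
    by (rule uncut_walk_stays_in_out_ball)
       (use p(4) v(2) v0 in \<open>auto simp: split successively_append_iff\<close>)
  moreover have "\<mu> w (hd (p1 @ [v])) v \<le> ereal R"
    by (rule uncut_walk_stays_in_in_ball)
       (use p(4) v(2) v0 in \<open>auto simp: split successively_append_iff successively_Cons\<close>)
  moreover have "last (v # p2) = y" "hd (p1 @ [v]) = x"
    using p by (auto simp: split hd_append split: if_splits)
  ultimately have "\<mu> w x v + \<mu> w v y \<le> ereal R + ereal R"
    by (intro add_mono) simp_all
  also have "\<dots> \<le> ereal r" using R by simp
  finally show "\<mu> w x y \<le> ereal r"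
    using shortest_path_triangle[OF xy(1,2) vG] by (rule order_trans[rotated])
qed

end

end

section \<open>The random radius\<close>

text \<open>The indices are integers in a half-open interval of length \<open>l / d\<close>; the 1
  pays for rounding at its ends.\<close>

lemma card_multiples_in_interval:
  fixes d :: real
  assumes "0 < d" and "0 \<le> l"
  shows "real (card {k::nat. a \<le> real k * d \<and> real k * d < a + l}) \<le> l / d + 1"
proof -
  let ?S = "{k::nat. a \<le> real k * d \<and> real k * d < a + l}"
  have "int ` ?S \<subseteq> {\<lceil>a / d\<rceil>..<\<lceil>(a + l) / d\<rceil>}"
    using assms by (auto simp: ceiling_le_iff less_ceiling_iff field_simps)
  then have "card (int ` ?S) \<le> card {\<lceil>a / d\<rceil>..<\<lceil>(a + l) / d\<rceil>}"
    by (rule card_mono[rotated]) simp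
  then have "card ?S \<le> nat (\<lceil>(a + l) / d\<rceil> - \<lceil>a / d\<rceil>)"
    by (simp add: card_image)
  moreover have "a / d \<le> (a + l) / d"
    using assms by (simp add: divide_right_mono)
  then have "\<lceil>a / d\<rceil> \<le> \<lceil>(a + l) / d\<rceil>"
    by (rule ceiling_mono)
  ultimately have "real (card ?S) \<le> real_of_int (\<lceil>(a + l) / d\<rceil> - \<lceil>a / d\<rceil>)"
    by (simp add: le_nat_iff)
  also have "\<dots> \<le> (a + l) / d + 1 - a / d"
    by (simp only: of_int_diff) linarith
  also have "\<dots> = l / d + 1"
    by (simp add: add_divide_distrib)
  finally show ?thesis .
qed

text \<open>Here \<open>x\<close> and \<open>y\<close> stand for distances between a hub and the two
  ends of an arc of length \<open>l\<close>. If \<open>x\<close> is infinite, no radius separates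
  them; otherwise both bounds are real.\<close>

lemma card_radii_separating:
  fixes d :: real and x y :: ereal
  assumes "0 < d" and "0 \<le> l" and "0 \<le> x" and "y \<le> x + ereal l"
  shows "real (card {k\<in>{..<N}. x \<le> ereal (real k * d) \<and> ereal (real k * d) < y}) \<le> l / d + 1"
proof (cases x)
  case (real a)
  let ?S = "{k::nat. a \<le> real k * d \<and> real k * d < a + l}"
  have "?S \<subseteq> {..<nat \<lceil>(a + l) / d\<rceil>}"
    using assms(1) by (auto simp: zless_nat_conj less_ceiling_iff pos_less_divide_eq zless_nat_eq_int_zless)
  then have "finite ?S" by (rule finite_subset) simp
  moreover have "{k\<in>{..<N}. x \<le> ereal (real k * d) \<and> ereal (real k * d) < y} \<subseteq> ?S"
    using real assms(4) by (auto dest: less_le_trans)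
  ultimately show ?thesis
    using card_multiples_in_interval[OF assms(1,2), of a] card_mono of_nat_mono order_trans
    by (metis (no_types, lifting))
qed (use assms in auto)

context fin_digraph
begin

context
  fixes w :: "'b \<Rightarrow> real"
  assumes pos: "\<And>e. e \<in> arcs G \<Longrightarrow> 0 < w e"
begin

text \<open>By the triangle inequality, each ball around \<open>v\<close> cuts the arc for at most
  \<open>w e / d + 1\<close> radii. The factor 2 counts the out-ball and the in-ball.\<close>

lemma card_radii_cutting:
  assumes e: "e \<in> arcs G" and d: "0 < d" and A: "A (tail G e) \<subseteq> verts G"
  shows "real (card {k\<in>{..<N}. cut_arc w A (real k * d) (tail G e) (head G e)})
    \<le> real (card (A (tail G e))) * (2 * (w e / d + 1))"
proof -
  let ?a = "tail G e" and ?b = "head G e"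
  define Out where "Out v = {k\<in>{..<N}. \<mu> w v ?a \<le> ereal (real k * d) \<and>
    ereal (real k * d) < \<mu> w v ?b}" for v
  define In where "In v = {k\<in>{..<N}. \<mu> w ?b v \<le> ereal (real k * d) \<and>
    ereal (real k * d) < \<mu> w ?a v}" for v
  have ab: "?a \<in> verts G" "?b \<in> verts G" using e by auto
  have "awalk ?a [e] ?b" using e by (simp add: awalk_Cons_iff awalk_Nil_iff)
  from min_cost_le_walk_cost[OF this, of w] have le: "\<mu> w ?a ?b \<le> ereal (w e)"
    by simp
  have w0: "0 \<le> w e" using pos[OF e] by simp
  have finA: "finite (A ?a)" using A finite_verts finite_subset by blast
  have "real (card (Out v \<union> In v)) \<le> 2 * (w e / d + 1)" if "v \<in> A ?a" for v
  proof -
    have v: "v \<in> verts G" using that A by auto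
    note tri = shortest_path_triangle[of w, OF pos] and nn = shortest_path_nonneg[of w, OF pos]
    have "\<mu> w v ?b \<le> \<mu> w v ?a + ereal (w e)"
      using tri[of v ?b ?a] v ab add_left_mono[OF le] order_trans by blast
    then have out: "real (card (Out v)) \<le> w e / d + 1"
      unfolding Out_def using nn[of v ?a] v ab by (intro card_radii_separating d w0) auto
    have "\<mu> w ?a v \<le> \<mu> w ?b v + ereal (w e)"
      using order_trans[OF tri[of ?a v ?b] add_right_mono[OF le, of "\<mu> w ?b v"]] v ab
      by (simp add: add.commute)
    then have inn: "real (card (In v)) \<le> w e / d + 1"
      unfolding In_def using nn[of ?b v] v ab by (intro card_radii_separating d w0) auto
    have "real (card (Out v \<union> In v)) \<le> real (card (Out v)) + real (card (In v))"
      using card_Un_le[of "Out v" "In v"] by linarith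
    also have "\<dots> \<le> (w e / d + 1) + (w e / d + 1)"
      by (rule add_mono[OF out inn])
    finally show ?thesis by simp
  qed
  then have sum: "(\<Sum>v\<in>A ?a. real (card (Out v \<union> In v))) \<le> real (card (A ?a)) * (2 * (w e / d + 1))"
    by (rule sum_bounded_above)
  have "{k\<in>{..<N}. cut_arc w A (real k * d) ?a ?b} = (\<Union>v\<in>A ?a. Out v \<union> In v)"
    by (auto simp: cut_arc_def Out_def In_def)
  then have "real (card {k\<in>{..<N}. cut_arc w A (real k * d) ?a ?b})
      \<le> (\<Sum>v\<in>A ?a. real (card (Out v \<union> In v)))"
    using card_UN_le[OF finA, of "\<lambda>v. Out v \<union> In v"] by (metis of_nat_mono of_nat_sum)
  with sum show ?thesis by linarith
qed

text \<open>A union bound along the walk, stated by counting radii: if the first arc is uncut and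
  its head reaches \<open>y\<close>, so does \<open>x\<close>.\<close>

lemma card_radii_not_reaching:
  assumes cut: "\<And>e. e \<in> arcs G \<Longrightarrow>
      real (card {k\<in>{..<N}. cut_arc w A (real k * d) (tail G e) (head G e)}) \<le> M * w e"
    and "awalk x p y"
  shows "real (card {k\<in>{..<N}. (x, y) \<notin> uncut_reach w A (real k * d)}) \<le> M * awalk_cost w p"
  using assms(2)
proof (induction p arbitrary: x)
  case Nil
  then show ?case by (auto simp: awalk_Nil_iff uncut_reach_def)
next
  case (Cons e p)
  let ?z = "head G e"
  have e: "e \<in> arcs G" "tail G e = x" and zy: "awalk ?z p y"
    using Cons.prems by (auto simp: awalk_Cons_iff)
  let ?X = "{k\<in>{..<N}. cut_arc w A (real k * d) (tail G e) (head G e)}"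
  let ?Y = "{k\<in>{..<N}. (?z, y) \<notin> uncut_reach w A (real k * d)}"
  have "{k\<in>{..<N}. (x, y) \<notin> uncut_reach w A (real k * d)} \<subseteq> ?X \<union> ?Y"
  proof clarsimp
    fix k assume *: "(x, y) \<notin> uncut_reach w A (real k * d)"
      "(?z, y) \<in> uncut_reach w A (real k * d)"
    show "cut_arc w A (real k * d) (tail G e) (head G e)"
    proof (rule ccontr)
      assume "\<not> ?thesis"
      then have "(x, ?z) \<in> uncut_arcs w A (real k * d)"
        using e by (auto simp: uncut_arcs_def arcs_ends_conv)
      then show False
        using * e by (auto simp: uncut_reach_def intro: converse_rtrancl_into_rtrancl)
    qed
  qed
  then have "card {k\<in>{..<N}. (x, y) \<notin> uncut_reach w A (real k * d)} \<le> card (?X \<union> ?Y)"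
    by (intro card_mono) auto
  also have "\<dots> \<le> card ?X + card ?Y" by (rule card_Un_le)
  finally have "real (card {k\<in>{..<N}. (x, y) \<notin> uncut_reach w A (real k * d)})
      \<le> real (card ?X) + real (card ?Y)" by linarith
  also have "\<dots> \<le> M * w e + M * awalk_cost w p"
    using cut[OF e(1)] Cons.IH[OF zy] by linarith
  finally show ?case by (simp add: distrib_left)
qed

text \<open>
  The radius is uniform on a grid whose mesh \<open>d\<close> is at most every arc length, so that the rounding
  in the number \<open>l/d + 1\<close> of grid points in an interval costs a factor 2 only.
\<close>

lemma lipschitz_distribution_of_hubs:
  assumes A: "\<And>u. A u \<subseteq> verts G" "\<And>u. card (A u) \<le> s" and s: "0 < s"
    and hubs: "\<And>W. W \<subseteq> verts G \<Longrightarrow> W \<noteq> {} \<Longrightarrow> connected_in (parcs (mk_symmetric G)) W \<Longrightarrow>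
      \<exists>v\<in>W. \<forall>u\<in>W. v \<in> A u"
    and r: "0 < r" and \<beta>: "8 * real s \<le> \<beta>"
  shows "\<exists>D. r_bounded_distribution (verts G) (\<mu> w) r D \<and>
    lipschitz_distribution (verts G) (\<mu> w) r \<beta> D"
proof -
  \<comment> \<open>The inserted 1 keeps the minimum defined when there are no arcs.\<close>
  define m where "m = Min (insert 1 (w ` arcs G))"
  have m: "0 < m" "\<And>e. e \<in> arcs G \<Longrightarrow> m \<le> w e"
    using pos by (auto simp: m_def)
  obtain N where "r / 2 / m < real N" using reals_Archimedean2 by blast
  moreover have "0 < r / 2 / m" using r m by simp
  ultimately have "0 < real N" "r / 2 < real N * m"
    using m(1) by (auto simp only: pos_divide_less_eq intro: less_trans)
  then have N: "0 < N" "r / 2 < real N * m" by simp_all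
  define d where "d = r / 2 / real N"
  have d: "0 < d" "real N * d = r / 2" "d \<le> m"
    using r N by (auto simp: d_def field_simps)
  \<comment> \<open>The radii \<open>0, d, ..., (N - 1) * d\<close> all lie below
    \<open>r / 2\<close>, as \<open>r_bounded_uncut_reach\<close> requires.\<close>
  define D where "D = map_pmf (\<lambda>k. uncut_reach w A (real k * d)) (pmf_of_set {..<N})"
  have ne: "{..<N} \<noteq> {}" using N by auto
  have "r_bounded_distribution (verts G) (\<mu> w) r D"
    unfolding r_bounded_distribution_def D_def
  proof (clarsimp simp: set_pmf_of_set[OF ne] quasipartition_uncut_reach)
    fix k assume "k < N"
    then have "real k * d \<le> real N * d" using d(1) by simp
    then show "r_bounded (\<mu> w) r (uncut_reach w A (real k * d))"
      using d by (intro r_bounded_uncut_reach pos hubs) auto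
  qed
  moreover have "lipschitz_distribution (verts G) (\<mu> w) r \<beta> D"
    unfolding lipschitz_distribution_def
  proof (intro ballI)
    fix x y assume xy: "x \<in> verts G" "y \<in> verts G"
    have \<beta>0: "0 < \<beta>" using \<beta> s by linarith
    show "ereal (measure_pmf.prob D {P. (x, y) \<notin> P}) \<le> ereal \<beta> * \<mu> w x y / ereal r"
    proof (cases "\<mu> w x y = \<infinity>")
      case True
      then show ?thesis using \<beta>0 r by simp
    next
      case False
      then obtain p where p: "apath x p y" "\<mu> w x y = ereal (awalk_cost w p)"
        using shortest_path_attained pos by blast
      have aw: "awalk x p y" using p(1) by (simp add: apath_def)
      have cost: "0 \<le> awalk_cost w p"
        using pos_cost_pos_awalk_cost[OF aw] pos by (meson less_imp_le)
      have "real (card {k\<in>{..<N}. cut_arc w A (real k * d) (tail G e) (head G e)})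
          \<le> (4 * real s / d) * w e" if e: "e \<in> arcs G" for e
      proof -
        \<comment> \<open>The rounding term is absorbed here, since \<open>d\<close> is at most
          \<open>m\<close> and hence at most \<open>w e\<close>.\<close>
        have "1 \<le> w e / d" using d m(2)[OF e] by simp
        then have "2 * (w e / d + 1) \<le> 4 * (w e / d)" "0 \<le> 2 * (w e / d + 1)" by auto
        then have "real (card (A (tail G e))) * (2 * (w e / d + 1)) \<le> real s * (4 * (w e / d))"
          using A(2) by - (rule mult_mono, simp_all)
        then show ?thesis
          using card_radii_cutting[where A = A, OF e d(1) A(1), of N] by (simp add: algebra_simps)
      qed
      then have cnt: "real (card {k\<in>{..<N}. (x, y) \<notin> uncut_reach w A (real k * d)})
          \<le> (4 * real s / d) * awalk_cost w p"
        by (rule card_radii_not_reaching[OF _ aw])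
      have "measure_pmf.prob D {P. (x, y) \<notin> P}
          = real (card {k\<in>{..<N}. (x, y) \<notin> uncut_reach w A (real k * d)}) / real N"
        using ne by (simp add: D_def measure_map_pmf measure_pmf_of_set vimage_def Int_def)
      also have "\<dots> \<le> (4 * real s / d) * awalk_cost w p / real N"
        using cnt by (rule divide_right_mono) simp
      also have "\<dots> = 4 * real s * awalk_cost w p / (real N * d)"
        by (simp add: mult.commute)
      \<comment> \<open>The 4 becomes 8 because the grid spans only \<open>r / 2\<close>.\<close>
      also have "\<dots> = 8 * real s * awalk_cost w p / r"
        unfolding d(2) by simp
      also have "\<dots> \<le> \<beta> * awalk_cost w p / r"
        using \<beta> cost r by (intro divide_right_mono mult_right_mono) auto
      finally show ?thesis using p(2) r by simp
    qed
  qed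
  ultimately show ?thesis by blast
qed

end

end

section \<open>Choice of the constants\<close>

theorem theorem8:
  shows "\<exists>C::real. C > 0 \<and>
    (\<forall>(n::nat) (t::nat) (G :: ('a, 'b) pre_digraph) (w :: 'b \<Rightarrow> real).
       n \<ge> 2 \<and> t \<ge> 1 \<and>
       fin_digraph G \<and> card (verts G) = n \<and> treewidth G = t \<and>
       (\<forall>e\<in>arcs G. w e > 0) \<longrightarrow>
       (\<forall>r::real. r > 0 \<longrightarrow>
          (\<exists>D :: ('a \<times> 'a) set pmf.
             r_bounded_distribution (verts G) (wf_digraph.\<mu> G w) r D \<and>
             lipschitz_distribution (verts G) (wf_digraph.\<mu> G w) r
               (C * real t * ln (real n)) D)))"
proof (intro exI[of _ "32 / ln 2"] conjI allI impI)
  \<comment> \<open>The 32 is 8 from \<open>lipschitz_distribution_of_hubs\<close>, times 2 from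
    \<open>t + 1 \<le> 2 * t\<close>, times 2 from bounding the depth \<open>m + 1\<close> by twice
    the binary logarithm of \<open>n\<close>.\<close>
  show "0 < 32 / ln (2::real)" by simp
next
  fix n t :: nat and G :: "('a, 'b) pre_digraph" and w :: "'b \<Rightarrow> real" and r :: real
  assume *: "n \<ge> 2 \<and> t \<ge> 1 \<and> fin_digraph G \<and> card (verts G) = n \<and> treewidth G = t \<and>
    (\<forall>e\<in>arcs G. w e > 0)" and r: "r > 0"
  interpret fin_digraph G using * by simp
  \<comment> \<open>The recursion needs \<open>n < 2 ^ (m + 1)\<close>, hence \<open>m + 1\<close>
    levels.\<close>
  obtain m where m: "2 ^ m \<le> n" "n < 2 ^ (m + 1)"
    using ex_power_ivl1[of 2 n] * by auto
  have nt: "card (verts G) = n" "treewidth G = t" using * by auto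
  from hubs_of_treewidth[of "m + 1", unfolded nt, OF m(2)] obtain A
    where A: "\<forall>u. finite (A u) \<and> card (A u) \<le> (m + 1) * (t + 1)"
      and hubs: "\<forall>W. W \<subseteq> verts G \<and> W \<noteq> {} \<and> connected_in (parcs (mk_symmetric G)) W \<longrightarrow>
        (\<exists>v\<in>W. \<forall>u\<in>W. v \<in> A u)"
    by (elim exE conjE) (rule that)
  have "ln ((2::real) ^ m) \<le> ln (real n)"
    using m(1) * by (subst ln_le_cancel_iff) (simp_all flip: of_nat_le_iff)
  moreover have "ln 2 \<le> ln (real n)"
    using * by (subst ln_le_cancel_iff) auto
  ultimately have "real (m + 1) * ln 2 \<le> 2 * ln (real n)"
    by (simp add: ln_realpow distrib_right)
  then have "real (m + 1) \<le> 2 * ln (real n) / ln 2"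
    by (simp add: pos_le_divide_eq)
  moreover have "real (t + 1) \<le> 2 * real t"
    using * by simp
  ultimately have "real (m + 1) * real (t + 1) \<le> (2 * ln (real n) / ln 2) * (2 * real t)"
    by (intro mult_mono) auto
  then have "8 * real ((m + 1) * (t + 1)) \<le> 8 * ((2 * ln (real n) / ln 2) * (2 * real t))"
    by (simp only: of_nat_mult)
  also have "\<dots> = 32 / ln 2 * real t * ln (real n)"
    by simp
  finally have \<beta>: "8 * real ((m + 1) * (t + 1)) \<le> 32 / ln 2 * real t * ln (real n)" .
  show "\<exists>D. r_bounded_distribution (verts G) (\<mu> w) r D \<and>
      lipschitz_distribution (verts G) (\<mu> w) r (32 / ln 2 * real t * ln (real n)) D"
  \<comment> \<open>Intersecting with \<open>verts G\<close> loses no hub, as a hub belongs to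
    \<open>W\<close>.\<close>
  proof (rule lipschitz_distribution_of_hubs[where A = "\<lambda>u. A u \<inter> verts G", OF _ _ _ _ _ r \<beta>])
    show "card (A u \<inter> verts G) \<le> (m + 1) * (t + 1)" for u
      using card_mono[of "A u" "A u \<inter> verts G"] A by (meson Int_lower1 order_trans)
    show "\<exists>v\<in>W. \<forall>u\<in>W. v \<in> A u \<inter> verts G"
      if "W \<subseteq> verts G" "W \<noteq> {}" "connected_in (parcs (mk_symmetric G)) W" for W
      using hubs that by (metis IntI subsetD)
  qed (use * in auto)
qed

end
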